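(* If the IKJ algorithm is repeated two times (in succession on the same array $\mathtt{d}$, initialized by $\mathtt{d}[i,j]\leftarrow w(i,j)$ for all $i,j\in V$ before the first run only), it solves the all-pairs shortest path problem, i.e., afterwards $\mathtt{d}[i,j]$ stores the shortest path distance from $i$ to $j$ for all $i,j\in V$. Conversely, there exists an instance that needs two repeats of the IKJ algorithm to obtain a correct solution, i.e., an instance for which a single run does not give the shortest path distances for all pairs.
   Context: Let $G=(V,E)$ be a complete directed graph with vertex set $V=\{1,\dots,n\}$, and let $w\colon V\times V\to\mathbb{R}\cup\{\infty\}$ be the length of the edges. It is assumed that $G$ has no negative cycles. An instance consists of such a $G$ and $w$. The length of a path is the sum of the lengths of its edges, and the shortest path distance from one vertex to another is the length of a shortest path between them. The all-pairs shortest path problem asks for the shortest path distances for all $i,j\in V$. The IKJ algorithm works on an $n\times n$ array $\mathtt{d}$, initialized by $\mathtt{d}[i,j]\leftarrow w(i,j)$ for all $i,j\in V$. One run consists of the following triply nested loops, updating $\mathtt{d}$ in place: for $i=1,2,\dots,n$ (outermost), for $k=1,2,\dots,n$ (middle), for $j=1,2,\dots,n$ (innermost), perform $\mathtt{d}[i,j]\leftarrow\min\{\mathtt{d}[i,j],\ \mathtt{d}[i,k]+\mathtt{d}[k,j]\}$. *)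

theory Defs
  imports "HOL-Library.Extended_Real"
begin

text \<open>
  The complete directed graph on the vertices \<open>{1..n}\<close> has all ordered pairs as edges, loops
  included; only the values \<open>w i j\<close> with \<open>i, j \<in> {1..n}\<close> matter.
  A path is the list of its vertices and has at least one edge; as usual for shortest paths,
  vertices may be repeated.  In particular the paths from \<open>i\<close> to \<open>i\<close> are the closed ones, so an
  entry \<open>w i i > 0\<close> is a meaningful edge length.  If \<open>w i i = 0\<close>, the distance from \<open>i\<close> to
  itself is \<open>0\<close>, as it would be with the one-vertex path admitted
  (\<open>shortest_path_distance_refl\<close> below).
\<close>

definition is_path :: "nat \<Rightarrow> nat \<Rightarrow> nat \<Rightarrow> nat list \<Rightarrow> bool" where
  "is_path n i j p \<longleftrightarrow> length p \<ge> 2 \<and> set p \<subseteq> {1..n} \<and> hd p = i \<and> last p = j"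

fun path_length :: "(nat \<Rightarrow> nat \<Rightarrow> ereal) \<Rightarrow> nat list \<Rightarrow> ereal" where
  "path_length w (u # v # p) = w u v + path_length w (v # p)"
| "path_length w _ = 0"

definition is_cycle :: "nat \<Rightarrow> nat list \<Rightarrow> bool" where
  "is_cycle n p \<longleftrightarrow> (\<exists>i. is_path n i i p)"

text \<open>Edge lengths lie in \<open>\<real> \<union> {\<infinity>}\<close>, hence the exclusion of \<open>-\<infinity>\<close>.\<close>

definition is_instance :: "nat \<Rightarrow> (nat \<Rightarrow> nat \<Rightarrow> ereal) \<Rightarrow> bool" where
  "is_instance n w \<longleftrightarrow>
     (\<forall>i\<in>{1..n}. \<forall>j\<in>{1..n}. w i j \<noteq> -\<infinity>) \<and>
     \<not> (\<exists>p. is_cycle n p \<and> path_length w p < 0)"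

definition is_shortest_path ::
  "nat \<Rightarrow> (nat \<Rightarrow> nat \<Rightarrow> ereal) \<Rightarrow> nat \<Rightarrow> nat \<Rightarrow> nat list \<Rightarrow> bool" where
  "is_shortest_path n w i j p \<longleftrightarrow>
     is_path n i j p \<and> (\<forall>q. is_path n i j q \<longrightarrow> path_length w p \<le> path_length w q)"

definition is_shortest_path_distance ::
  "nat \<Rightarrow> (nat \<Rightarrow> nat \<Rightarrow> ereal) \<Rightarrow> nat \<Rightarrow> nat \<Rightarrow> ereal \<Rightarrow> bool" where
  "is_shortest_path_distance n w i j x \<longleftrightarrow>
     (\<exists>p. is_shortest_path n w i j p \<and> path_length w p = x)"

definition solves_apsp :: "nat \<Rightarrow> (nat \<Rightarrow> nat \<Rightarrow> ereal) \<Rightarrow> (nat \<Rightarrow> nat \<Rightarrow> ereal) \<Rightarrow> bool" where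
  "solves_apsp n w d \<longleftrightarrow>
     (\<forall>i\<in>{1..n}. \<forall>j\<in>{1..n}. is_shortest_path_distance n w i j (d i j))"

definition relax :: "nat \<Rightarrow> nat \<Rightarrow> nat \<Rightarrow> (nat \<Rightarrow> nat \<Rightarrow> ereal) \<Rightarrow> (nat \<Rightarrow> nat \<Rightarrow> ereal)" where
  "relax i k j d = d(i := (d i)(j := min (d i j) (d i k + d k j)))"

text \<open>The outermost \<^const>\<open>fold\<close> is the loop over \<open>i\<close>, the innermost one the loop over \<open>j\<close>.\<close>

definition ikj :: "nat \<Rightarrow> (nat \<Rightarrow> nat \<Rightarrow> ereal) \<Rightarrow> (nat \<Rightarrow> nat \<Rightarrow> ereal)" where
  "ikj n d =
     fold (\<lambda>i. fold (\<lambda>k. fold (\<lambda>j. relax i k j) [1..<Suc n]) [1..<Suc n]) [1..<Suc n] d"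

lemma shortest_path_distance_refl:
  assumes "is_instance n w" "i \<in> {1..n}" "w i i = 0"
  shows "is_shortest_path_distance n w i i 0"
proof -
  have "is_path n i i [i, i]" "path_length w [i, i] = 0"
    using assms by (auto simp: is_path_def)
  moreover have "0 \<le> path_length w q" if "is_path n i i q" for q
    using assms(1) that unfolding is_instance_def is_cycle_def by (meson not_less)
  ultimately show ?thesis
    unfolding is_shortest_path_distance_def is_shortest_path_def by metis
qed

end

theory Submission
  imports Defs
begin

text \<open>
  Consider the middle loop for a fixed \<open>i\<close> as the outer loop of Floyd--Warshall, restricted to
  row \<open>i\<close>: before step \<open>k\<close>, \<open>d i j\<close> is at most the length of every path from \<open>i\<close> to \<open>j\<close> with
  interior vertices below \<open>k\<close>. To extend this to \<open>k\<close>, split a path at its first and its last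
  visit of \<open>k\<close> and drop the closed part in between; the step works if row \<open>k\<close> already accounts
  for the paths from \<open>k\<close> with interior vertices below \<open>k\<close>. During the first run this holds
  for \<open>k < i\<close>, by induction on \<open>i\<close>, which gives the same property for row \<open>i\<close>. Hence it holds
  for all rows when the second run starts, and the second run covers all paths.

  One run fails on the path 1, 3, 2, 4: when row 1 is processed, row 2 is consulted before \<open>d 1 2\<close>
  accounts for the path 1, 3, 2.
\<close>

section \<open>Folds and concatenation of paths\<close>

lemma fold_decreasing:
  fixes d :: "'a::preorder"
  assumes "\<And>x d. f x d \<le> d"
  shows "fold f xs d \<le> d"
proof (induction xs arbitrary: d)
  case (Cons x xs)
  show ?case using order_trans[OF Cons.IH assms] by simp
qed simp

lemma upt_split: "i \<le> j \<Longrightarrow> j \<le> k \<Longrightarrow> [i..<k] = [i..<j] @ [j..<k]"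
  using upt_add_eq_append[of i j "k - j"] by simp

lemma path_length_append:
  "path_length w (xs @ k # ys) = path_length w (xs @ [k]) + path_length w (k # ys)"
  by (induction xs rule: induct_list012) (simp_all add: add.assoc)

lemma path_length_nonneg:
  assumes "\<And>u v. 0 \<le> w u v"
  shows "0 \<le> path_length w p"
  using assms by (induction p rule: induct_list012) simp_all

lemma is_path_join:
  assumes "is_path n i k p" "is_path n k j q"
  shows "\<exists>r. is_path n i j r \<and> path_length w r = path_length w p + path_length w q"
proof -
  obtain p' where p: "p = p' @ [k]" "p' \<noteq> []"
    using assms(1) unfolding is_path_def
    by (cases p rule: rev_cases) (auto simp: Suc_le_eq)
  obtain q' where q: "q = k # q'" "q' \<noteq> []"
    using assms(2) unfolding is_path_def
    by (cases q) (auto simp: Suc_le_eq)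
  have "is_path n i j (p' @ k # q')"
    using assms p q unfolding is_path_def by (auto simp: hd_append Suc_le_eq)
  then show ?thesis
    using path_length_append p(1) q(1) by blast
qed

text \<open>The minimum of two list entries keeps the endpoints apart as separate occurrences even
  if \<open>i = j\<close>.\<close>

lemma is_path_interior:
  assumes "is_path n i j p"
  obtains vs where "p = i # vs @ [j]" "set vs \<subseteq> {1..n}"
proof -
  obtain q where q: "p = i # q" "q \<noteq> []"
    using assms unfolding is_path_def by (cases p) (auto simp: Suc_le_eq)
  then obtain vs where "q = vs @ [j]"
    using assms unfolding is_path_def by (cases q rule: rev_cases) auto
  then show ?thesis using that assms q unfolding is_path_def by auto
qed

section \<open>Every entry is the length of a path\<close>

lemma relax_decreasing: "relax i k j d \<le> d"
  by (auto simp: relax_def le_fun_def)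

text \<open>Loop invariant that keeps entries from falling below the distance and supplies the path
  attaining the minimum at the end.\<close>

definition realized :: "nat \<Rightarrow> (nat \<Rightarrow> nat \<Rightarrow> ereal) \<Rightarrow> (nat \<Rightarrow> nat \<Rightarrow> ereal) \<Rightarrow> bool" where
  "realized n w d \<longleftrightarrow>
     (\<forall>i\<in>{1..n}. \<forall>j\<in>{1..n}. \<exists>p. is_path n i j p \<and> path_length w p = d i j)"

lemma realized_self: "realized n w w"
  unfolding realized_def
proof (intro ballI)
  fix i j assume "i \<in> {1..n}" "j \<in> {1..n}"
  then have "is_path n i j [i, j] \<and> path_length w [i, j] = w i j"
    by (auto simp: is_path_def)
  then show "\<exists>p. is_path n i j p \<and> path_length w p = w i j" by blast
qed

lemma realized_relax:
  assumes d: "realized n w d" and "i \<in> {1..n}" "k \<in> {1..n}" "j \<in> {1..n}"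
  shows "realized n w (relax i k j d)"
proof -
  obtain p q where "is_path n i k p" "path_length w p = d i k"
      "is_path n k j q" "path_length w q = d k j"
    using assms unfolding realized_def by meson
  then obtain r where "is_path n i j r" "path_length w r = d i k + d k j"
    using is_path_join by metis
  then show ?thesis
    using d unfolding realized_def relax_def by (auto simp: min_def)
qed

lemma realized_ikj:
  assumes "realized n w d"
  shows "realized n w (ikj n d)"
  unfolding ikj_def
  by (intro fold_invariant[where P = "realized n w" and Q = "\<lambda>v. v \<in> {1..n}"] assms
      realized_relax) auto

section \<open>Upper bounds on the rows through both runs\<close>

definition relax_row :: "nat \<Rightarrow> nat \<Rightarrow> nat \<Rightarrow> (nat \<Rightarrow> nat \<Rightarrow> ereal) \<Rightarrow> (nat \<Rightarrow> nat \<Rightarrow> ereal)" where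
  "relax_row n i k = fold (relax i k) [1..<Suc n]"

lemma ikj_relax_row: "ikj n = fold (\<lambda>i. fold (relax_row n i) [1..<Suc n]) [1..<Suc n]"
  unfolding relax_row_def by (rule ext) (rule ikj_def)

lemma relax_row_decreasing: "relax_row n i k d \<le> d"
  unfolding relax_row_def by (intro fold_decreasing relax_decreasing)

lemma relax_rows_decreasing: "fold (relax_row n i) ks d \<le> d"
  by (intro fold_decreasing relax_row_decreasing)

lemma ikj_decreasing: "ikj n d \<le> d"
  unfolding ikj_relax_row by (intro fold_decreasing relax_row_decreasing)

text \<open>The update is in place, so \<open>d i k\<close>, and also \<open>d k j\<close> if
  \<open>k = i\<close>, may change before \<open>j\<close> is reached. They can only decrease, so
  the bound by the initial values survives.\<close>

lemma fold_relax_le: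
  assumes "j \<in> set js"
  shows "fold (relax i k) js d i j \<le> d i k + d k j"
  using assms
proof (induction js arbitrary: d)
  case (Cons a js)
  show ?case
  proof (cases "j = a")
    case True
    have "fold (relax i k) js (relax i k a d) i j \<le> relax i k a d i j"
      by (rule le_funD[OF le_funD[OF fold_decreasing[OF relax_decreasing]]])
    also have "\<dots> \<le> d i k + d k j"
      using True by (simp add: relax_def)
    finally show ?thesis by simp
  next
    case False
    then have "fold (relax i k) js (relax i k a d) i j \<le> relax i k a d i k + relax i k a d k j"
      using Cons by simp
    also have "\<dots> \<le> d i k + d k j"
      using relax_decreasing by (intro add_mono) (simp_all add: le_fun_def)
    finally show ?thesis by simp
  qed
qed simp

lemma relax_row_le: "j \<in> {1..n} \<Longrightarrow> relax_row n i k d i j \<le> d i k + d k j"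
  unfolding relax_row_def by (rule fold_relax_le) auto

text \<open>\<open>K\<close> is an exclusive bound on the interior vertices \<open>vs\<close> only;
  \<open>vs\<close> may repeat vertices, so that all paths are covered once
  \<open>K = Suc n\<close>.\<close>

definition row_le_paths ::
  "nat \<Rightarrow> (nat \<Rightarrow> nat \<Rightarrow> ereal) \<Rightarrow> nat \<Rightarrow> (nat \<Rightarrow> nat \<Rightarrow> ereal) \<Rightarrow> nat \<Rightarrow> bool" where
  "row_le_paths n w K d i \<longleftrightarrow>
     (\<forall>j\<in>{1..n}. \<forall>vs. set vs \<subseteq> {1..<K} \<longrightarrow> d i j \<le> path_length w (i # vs @ [j]))"

lemma row_le_paths_mono:
  assumes "row_le_paths n w K d i" "d' \<le> d"
  shows "row_le_paths n w K d' i"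
  using assms unfolding row_le_paths_def le_fun_def by (meson order_trans)

lemma relax_rows_le_paths:
  assumes inst: "is_instance n w" and le: "d \<le> w" and K: "1 \<le> K" "K \<le> Suc n"
    and rows: "\<And>k. k \<in> {1..<K} \<Longrightarrow> row_le_paths n w k d k"
  shows "row_le_paths n w K (fold (relax_row n i) [1..<K] d) i"
  using K rows
proof (induction K rule: dec_induct)
  case base
  then show ?case using le by (auto simp: row_le_paths_def le_fun_def)
next
  case (step k)
  define e where "e = fold (relax_row n i) [1..<k] d"
  have e: "row_le_paths n w k e i"
    unfolding e_def using step by simp
  have k: "k \<in> {1..n}" and dk: "row_le_paths n w k d k" using step by auto
  \<comment> \<open>Step \<open>k\<close> reads row \<open>k\<close> of \<open>e\<close>, while
    \<open>dk\<close> speaks of \<open>d\<close>; the two can differ when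
    \<open>k = i\<close>.\<close>
  have ek: "e k j \<le> d k j" for j
    unfolding e_def using relax_rows_decreasing by (simp add: le_fun_def)
  have "relax_row n i k e i j \<le> path_length w (i # vs @ [j])"
    if j: "j \<in> {1..n}" and vs: "set vs \<subseteq> {1..<Suc k}" for j vs
  proof (cases "k \<in> set vs")
    case False
    have "relax_row n i k e i j \<le> e i j"
      using relax_row_decreasing by (simp add: le_fun_def)
    also have "\<dots> \<le> path_length w (i # vs @ [j])"
    proof -
      have "set vs \<subseteq> {1..<k}" using vs False by (auto simp: less_Suc_eq)
      then show ?thesis using e j unfolding row_le_paths_def by blast
    qed
    finally show ?thesis .
  next
    case True
    then obtain as bs where ab: "vs = as @ k # bs" "k \<notin> set as"
      using split_list_first by metis
    have as: "set as \<subseteq> {1..<k}" using vs ab by (auto simp: less_Suc_eq)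
    have 2: "d k j \<le> path_length w (k # bs @ [j])"
    proof (cases "k \<in> set bs")
      case False
      then have "set bs \<subseteq> {1..<k}" using vs ab by (auto simp: less_Suc_eq)
      then show ?thesis using dk j unfolding row_le_paths_def by blast
    next
      case True
      then obtain cs ds where cd: "bs = cs @ k # ds" "k \<notin> set ds"
        using split_list_last by metis
      have ds: "set ds \<subseteq> {1..<k}" using vs ab cd by (auto simp: less_Suc_eq)
      \<comment> \<open>\<open>cs\<close> may visit \<open>k\<close> again; this is harmless, since
        cycles are arbitrary closed walks.\<close>
      have "is_cycle n (k # cs @ [k])"
        using k vs ab cd by (force simp: is_cycle_def is_path_def)
      then have cyc: "0 \<le> path_length w (k # cs @ [k])"
        using inst unfolding is_instance_def by (meson not_less)
      have "d k j \<le> path_length w (k # ds @ [j])"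
        using dk j ds unfolding row_le_paths_def by blast
      also have "\<dots> \<le> path_length w (k # cs @ [k]) + path_length w (k # ds @ [j])"
        using add_right_mono[OF cyc, of "path_length w (k # ds @ [j])"] by simp
      also have "\<dots> = path_length w (k # bs @ [j])"
        using path_length_append[of w "k # cs" k "ds @ [j]"] cd by simp
      finally show ?thesis .
    qed
    have "relax_row n i k e i j \<le> e i k + e k j"
      using j by (rule relax_row_le)
    also have "\<dots> \<le> path_length w (i # as @ [k]) + path_length w (k # bs @ [j])"
      using e k as ek[of j] 2 unfolding row_le_paths_def
      by (intro add_mono) (auto intro: order_trans)
    also have "\<dots> = path_length w (i # vs @ [j])"
      using path_length_append[of w "i # as" k "bs @ [j]"] ab by simp
    finally show ?thesis .
  qed
  then show ?case
    using step(1) by (simp add: row_le_paths_def e_def)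
qed

text \<open>Row \<open>m\<close> gets only the bound \<open>m\<close>: its steps
  \<open>k < m\<close> read rows already prepared, whereas later steps read rows without a
  guarantee. This is exactly the hypothesis on rows in \<open>relax_rows_le_paths\<close>.\<close>

lemma first_run:
  assumes inst: "is_instance n w" and "1 \<le> I" "I \<le> Suc n"
  shows "\<forall>m\<in>{1..<I}. row_le_paths n w m
           (fold (\<lambda>i. fold (relax_row n i) [1..<Suc n]) [1..<I] w) m"
  using assms(2,3)
proof (induction I rule: dec_induct)
  case base
  then show ?case by simp
next
  case (step i)
  define e where "e = fold (\<lambda>i. fold (relax_row n i) [1..<Suc n]) [1..<i] w"
  define e' where "e' = fold (relax_row n i) [1..<Suc n] e"
  have rows: "row_le_paths n w m e m" if "m \<in> {1..<i}" for m
    using step that unfolding e_def by (simp del: upt_Suc)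
  have "e \<le> w"
    unfolding e_def by (intro fold_decreasing relax_rows_decreasing)
  then have "row_le_paths n w i (fold (relax_row n i) [1..<i] e) i"
    using step rows by (intro relax_rows_le_paths[OF inst]) auto
  \<comment> \<open>The remaining steps \<open>k \<ge> i\<close> can only lower entries.\<close>
  moreover have "e' \<le> fold (relax_row n i) [1..<i] e"
  proof -
    have "[1..<Suc n] = [1..<i] @ [i..<Suc n]"
      using step by (intro upt_split) auto
    then have "e' = fold (relax_row n i) [i..<Suc n] (fold (relax_row n i) [1..<i] e)"
      by (simp only: e'_def fold_append comp_apply)
    then show ?thesis by (simp only: relax_rows_decreasing)
  qed
  ultimately have i: "row_le_paths n w i e' i" by (rule row_le_paths_mono)
  have "row_le_paths n w m e' m" if "m \<in> {1..<Suc i}" for m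
  proof (cases "m = i")
    case False
    then show ?thesis
      using that rows[of m] row_le_paths_mono relax_rows_decreasing unfolding e'_def by force
  qed (use i in simp)
  moreover have "fold (\<lambda>i. fold (relax_row n i) [1..<Suc n]) [1..<Suc i] w = e'"
    using step(1) by (simp add: e_def e'_def)
  ultimately show ?case by (simp only:) blast
qed

text \<open>All rows are now prepared, so the middle loop can be followed up to
  \<open>K = Suc n\<close> instead of stopping at \<open>i\<close>. Rows changed earlier in this run
  stay prepared, as they only decrease.\<close>

lemma second_run:
  assumes inst: "is_instance n w" and le: "d \<le> w" and i: "i \<in> {1..n}"
    and rows: "\<And>k. k \<in> {1..n} \<Longrightarrow> row_le_paths n w k d k"
  shows "row_le_paths n w (Suc n) (ikj n d) i"
proof -
  let ?f = "\<lambda>i. fold (relax_row n i) [1..<Suc n]"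
  define e where "e = fold ?f [1..<i] d"
  have e: "e \<le> d"
    unfolding e_def by (intro fold_decreasing relax_rows_decreasing)
  have "row_le_paths n w (Suc n) (?f i e) i"
    using e le
    by (intro relax_rows_le_paths[OF inst])
      (auto intro: order_trans row_le_paths_mono[OF rows])
  moreover have "ikj n d \<le> ?f i e"
  proof -
    have "[1..<Suc n] = [1..<i] @ i # [Suc i..<Suc n]"
      using i upt_split[of 1 i "Suc n"] upt_conv_Cons[of i "Suc n"]
      by (simp del: upt_Suc)
    then have "ikj n d = fold ?f [Suc i..<Suc n] (?f i e)"
      unfolding ikj_relax_row e_def by (simp only: fold_append fold_simps comp_apply)
    then show ?thesis
      by (simp only: fold_decreasing[of ?f, OF relax_rows_decreasing])
  qed
  ultimately show ?thesis by (rule row_le_paths_mono)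
qed

lemma ikj_twice_correct:
  assumes inst: "is_instance n w"
  shows "solves_apsp n w (ikj n (ikj n w))"
  unfolding solves_apsp_def
proof (intro ballI)
  fix i j assume i: "i \<in> {1..n}" and j: "j \<in> {1..n}"
  let ?d = "ikj n (ikj n w)"
  have "row_le_paths n w k (ikj n w) k" if "k \<in> {1..n}" for k
    using first_run[OF inst, of "Suc n"] that by (simp add: ikj_relax_row)
  then have "row_le_paths n w (Suc n) ?d i"
    using i by (intro second_run[OF inst ikj_decreasing])
  \<comment> \<open>With \<open>K = Suc n\<close> the restriction on interior vertices is
    void.\<close>
  then have "?d i j \<le> path_length w q" if "is_path n i j q" for q
    using that j unfolding row_le_paths_def
    by (elim is_path_interior) (auto simp: atLeastLessThanSuc_atLeastAtMost)
  moreover obtain p where "is_path n i j p" "path_length w p = ?d i j"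
    using realized_ikj[OF realized_ikj[OF realized_self]] i j unfolding realized_def by meson
  ultimately show "is_shortest_path_distance n w i j (?d i j)"
    unfolding is_shortest_path_distance_def is_shortest_path_def by metis
qed

section \<open>An instance on which one run fails\<close>

lemma fold_other_row:
  assumes "\<And>x d. x \<in> set xs \<Longrightarrow> f x d m = d m"
  shows "fold f xs d m = d m"
  using assms by (induction xs arbitrary: d) auto

lemma relax_rows_other:
  assumes "m \<noteq> i"
  shows "fold (relax_row n i) ks d m = d m"
  unfolding relax_row_def using assms by (intro fold_other_row) (simp add: relax_def)

lemma ikj_once_incorrect: "\<exists>n w. is_instance n w \<and> \<not> solves_apsp n w (ikj n w)"
proof -
  \<comment> \<open>Only loops and the edges of the path 1, 3, 2, 4 are free. Nonnegative lengths
    exclude negative cycles.\<close>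
  define w :: "nat \<Rightarrow> nat \<Rightarrow> ereal" where
    "w = (\<lambda>i j. if i = j \<or> (i, j) \<in> {(1, 3), (3, 2), (2, 4)} then 0 else 1)"
  have "is_instance 4 w"
    using path_length_nonneg[of w] by (auto simp: is_instance_def w_def not_less)
  moreover have "\<not> solves_apsp 4 w (ikj 4 w)"
  proof
    assume "solves_apsp 4 w (ikj 4 w)"
    then have "is_shortest_path_distance 4 w 1 4 (ikj 4 w 1 4)"
      by (simp add: solves_apsp_def)
    moreover have "is_path 4 1 4 [1, 3, 2, 4]" "path_length w [1, 3, 2, 4] = 0"
      by (simp_all add: is_path_def w_def)
    ultimately have "ikj 4 w 1 4 \<le> 0"
      unfolding is_shortest_path_distance_def is_shortest_path_def by metis
    moreover have "ikj 4 w 1 4 = 1"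
    proof -
      let ?f = "\<lambda>i. fold (relax_row 4 i) [1..<Suc 4]"
      \<comment> \<open>Row 1 is written only in the first outer iteration, so evaluating that
        iteration suffices.\<close>
      have "[1..<Suc 4] = 1 # [2..<Suc 4]"
        by (simp add: upt_rec)
      then have "ikj 4 w = fold ?f [2..<Suc 4] (?f 1 w)"
        unfolding ikj_relax_row by (simp only: fold_simps)
      then have "ikj 4 w 1 = ?f 1 w 1"
        using fold_other_row[of "[2..<Suc 4]" ?f 1] relax_rows_other by auto
      \<comment> \<open>The entry for (1, 2) drops to 0 only at \<open>k = 3\<close>, after row 2
        was consulted at \<open>k = 2\<close>.\<close>
      moreover have "?f 1 w 1 4 = 1"
        by (simp add: relax_row_def relax_def w_def upt_rec)
      ultimately show ?thesis by simp
    qed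
    ultimately show False by simp
  qed
  ultimately show ?thesis by blast
qed

theorem theorem2:
  shows "(\<forall>n w. is_instance n w \<longrightarrow> solves_apsp n w ((ikj n ^^ 2) w)) \<and>
         (\<exists>n w. is_instance n w \<and> \<not> solves_apsp n w (ikj n w))"
  using ikj_twice_correct ikj_once_incorrect by (simp add: numeral_2_eq_2)

end
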